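(* If $G$ is a randomly $3$-dimensional graph, then $G$ is $3$-regular.
   Context: All graphs are finite, simple and connected. For an ordered set $W=\{w_1,\dots,w_k\}\subseteq V(G)$ and $v\in V(G)$, $r(v|W)=(d(v,w_1),\dots,d(v,w_k))$, where $d$ denotes graph distance. $W$ is a resolving set if distinct vertices have distinct representations with respect to $W$; a basis is a minimum-size resolving set and its size is the metric dimension $\beta(G)$. $G$ is randomly $k$-dimensional if $\beta(G)=k$ and every $k$-subset of $V(G)$ is a basis of $G$. *)

theory Defs
  imports "Graph_Theory.Graph_Theory" "HOL-Library.FuncSet"
begin

text \<open>Meaningful for endpoints joined by a walk; otherwise the value is unspecified.\<close>

definition graph_dist :: "('a, 'b) pre_digraph \<Rightarrow> 'a \<Rightarrow> 'a \<Rightarrow> nat" where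
  "graph_dist G u v = (LEAST n. \<exists>p. pre_digraph.awalk G u p v \<and> length p = n)"

text \<open>The representation $r(v|W)$ is the tuple of distances indexed by $W$ itself, so that no
  ordering of $W$ has to be chosen; \<open>metric_rep_eq_iff_list\<close> below recovers the reading
  with an ordered set.\<close>

definition metric_rep :: "('a, 'b) pre_digraph \<Rightarrow> 'a set \<Rightarrow> 'a \<Rightarrow> 'a \<Rightarrow> nat" where
  "metric_rep G W v = (\<lambda>w\<in>W. graph_dist G v w)"

lemma metric_rep_eq_iff_list:
  "metric_rep G (set ws) u = metric_rep G (set ws) v \<longleftrightarrow>
    map (graph_dist G u) ws = map (graph_dist G v) ws"
  unfolding metric_rep_def by (auto simp: restrict_def fun_eq_iff)

definition resolving_set :: "('a, 'b) pre_digraph \<Rightarrow> 'a set \<Rightarrow> bool" where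
  "resolving_set G W \<longleftrightarrow> W \<subseteq> verts G \<and> inj_on (metric_rep G W) (verts G)"

definition metric_basis :: "('a, 'b) pre_digraph \<Rightarrow> 'a set \<Rightarrow> bool" where
  "metric_basis G W \<longleftrightarrow> resolving_set G W \<and> (\<forall>W'. resolving_set G W' \<longrightarrow> card W \<le> card W')"

definition metric_dim :: "('a, 'b) pre_digraph \<Rightarrow> nat" where
  "metric_dim G = (LEAST k. \<exists>W. resolving_set G W \<and> card W = k)"

definition randomly_dimensional :: "nat \<Rightarrow> ('a, 'b) pre_digraph \<Rightarrow> bool" where
  "randomly_dimensional k G \<longleftrightarrow>
    metric_dim G = k \<and> (\<forall>W. W \<subseteq> verts G \<and> card W = k \<longrightarrow> metric_basis G W)"

text \<open>In a symmetric digraph without multiple arcs, the arcs leaving a vertex correspond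
  one-to-one to its incident undirected edges, so \<open>out_degree\<close> is the usual degree.\<close>

definition regular_graph :: "nat \<Rightarrow> ('a, 'b) pre_digraph \<Rightarrow> bool" where
  "regular_graph k G \<longleftrightarrow> (\<forall>v \<in> verts G. out_degree G v = k)"

end

theory Submission
  imports Defs
begin

text \<open>
  Let \<open>E(x, y)\<close> be the set of vertices equidistant from \<open>x\<close> and \<open>y\<close>. Every 3-set resolves, so
  \<open>E(x, y)\<close> has at most two elements; no 2-set resolves, so every pair of vertices is contained in
  some \<open>E(x, y)\<close>. Counting pairs, \<open>E\<close> is a bijection on the set of 2-subsets. In particular the
  number of pairs on a common sphere around \<open>w\<close> is \<open>n - 1\<close>, that is, averaged over the vertices
  other than \<open>w\<close> the size of the sphere around \<open>w\<close> through a vertex is exactly 3.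

  The distances from a vertex \<open>z\<close> to the \<open>m\<close> neighbours of \<open>w\<close> take at most three values. For
  \<open>m \<ge> 4\<close> the resulting coincidences give \<open>(n - 1)(2m - 6) \<le> m(m - 1)\<close>, whereas the sphere
  average gives \<open>m(m - 1) \<le> 2(n - 1)\<close>; so \<open>m = 4\<close>, \<open>n = 7\<close> and the graph has a leaf, which is
  impossible since \<open>E\<close> of a leaf and its neighbour is empty. For \<open>m = 3\<close> the same count yields
  \<open>n \<le> 10\<close>.

  If \<open>w\<close> has just two neighbours \<open>a\<close>, \<open>b\<close>, then, as the spheres around \<open>w\<close> do not grow from
  radius 2 on, the average forces the second sphere to have four elements, two adjacent to \<open>a\<close> and
  two adjacent to \<open>b\<close>. Hence \<open>a\<close> has degree 3 and \<open>n \<le> 10\<close>. The sets \<open>E(w, a)\<close>, \<open>E(w, b)\<close>,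
  \<open>E(a, b)\<close> each contain a further vertex, so that \<open>n = 10\<close>, and no distribution of these three
  vertices over spheres gives the right average.
\<close>

section \<open>Counting preliminaries and the metric setting\<close>

lemma card_filter_eq_sum: "finite A \<Longrightarrow> card {x\<in>A. Q x} = (\<Sum>x\<in>A. if Q x then 1 else 0)"
  by (simp add: sum.If_cases Int_def)

text \<open>Over the integers this is \<open>(p - 1) * (p - 2) \<ge> 0\<close>. Summed over three
  classes it bounds a sum of squares from below, with equality for classes of sizes 1 and 2.\<close>

lemma three_mult_le_square_plus_2: "3 * p \<le> p * p + (2::nat)"
proof -
  consider "p = 0" | "p = 1" | q where "p = q + 2"
    by (metis One_nat_def Suc_1 add.commute le_Suc_ex less_2_cases not_less)
  then show ?thesis by cases (auto simp: algebra_simps)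
qed

text \<open>The graph enters only through its distances. \<open>dist_step\<close> retains the last
  step of a shortest path, \<open>card_equidistant_le\<close> expresses that every 3-subset
  resolves, and \<open>pair_not_resolving\<close> that no 2-subset does.\<close>

locale randomly_3_dimensional_metric =
  fixes V :: "'a set" and d :: "'a \<Rightarrow> 'a \<Rightarrow> nat"
  assumes finite_V [simp, intro]: "finite V"
    and card_V: "card V > 3"
    and dist_eq_0 [simp]: "\<lbrakk>x \<in> V; y \<in> V\<rbrakk> \<Longrightarrow> d x y = 0 \<longleftrightarrow> x = y"
    and dist_sym: "\<lbrakk>x \<in> V; y \<in> V\<rbrakk> \<Longrightarrow> d x y = d y x"
    and dist_triangle: "\<lbrakk>x \<in> V; y \<in> V; z \<in> V\<rbrakk> \<Longrightarrow> d x z \<le> d x y + d y z"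
    and dist_step: "\<lbrakk>x \<in> V; y \<in> V; d x y = Suc k\<rbrakk> \<Longrightarrow> \<exists>u\<in>V. d x u = k \<and> d u y = 1"
    and card_equidistant_le: "\<lbrakk>x \<in> V; y \<in> V; x \<noteq> y\<rbrakk> \<Longrightarrow> card {z\<in>V. d x z = d y z} \<le> 2"
    and pair_not_resolving: "\<lbrakk>a \<in> V; b \<in> V; a \<noteq> b\<rbrakk> \<Longrightarrow>
      \<exists>x\<in>V. \<exists>y\<in>V. x \<noteq> y \<and> d x a = d y a \<and> d x b = d y b"
begin

section \<open>Equidistant pairs\<close>

definition equidistant :: "'a \<Rightarrow> 'a \<Rightarrow> 'a set" where
  "equidistant x y = {z\<in>V. d x z = d y z}"

text \<open>The sphere of radius \<open>k\<close>; \<open>level w 1\<close> is the neighbourhood of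
  \<open>w\<close>, so its cardinality is the degree.\<close>

definition level :: "'a \<Rightarrow> nat \<Rightarrow> 'a set" where
  "level w k = {x\<in>V. d w x = k}"

lemma dist_self [simp]: "x \<in> V \<Longrightarrow> d x x = 0"
  by simp

lemma finite_level [simp, intro]: "finite (level w k)"
  by (simp add: level_def)

lemma finite_equidistant [simp, intro]: "finite (equidistant x y)"
  by (simp add: equidistant_def)

lemma equidistant_commute: "equidistant x y = equidistant y x"
  by (auto simp: equidistant_def)

text \<open>A pair contained in some \<open>equidistant x y\<close> exhausts it, as that set has at
  most two elements. So the induced map on unordered pairs covers all pairs, and by finiteness it is
  injective and takes no other values.\<close>

lemma equidistant_bij:
  shows card_equidistant: "\<lbrakk>x \<in> V; y \<in> V; x \<noteq> y\<rbrakk> \<Longrightarrow> card (equidistant x y) = 2"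
    and equidistant_inj: "\<lbrakk>x \<in> V; y \<in> V; x \<noteq> y; u \<in> V; v \<in> V; u \<noteq> v; equidistant x y = equidistant u v\<rbrakk>
      \<Longrightarrow> {x, y} = {u, v}"
    and equidistant_surj: "\<lbrakk>a \<in> V; b \<in> V; a \<noteq> b\<rbrakk> \<Longrightarrow> \<exists>x\<in>V. \<exists>y\<in>V. x \<noteq> y \<and> equidistant x y = {a, b}"
proof -
  define P where "P = {B. B \<subseteq> V \<and> card B = 2}"
  \<comment> \<open>Defined on sets rather than on \<open>x\<close> and \<open>y\<close>, so that
    injectivity concerns unordered pairs.\<close>
  define E where "E B = {z\<in>V. \<forall>x\<in>B. \<forall>y\<in>B. d x z = d y z}" for B
  have E_pair: "E {x, y} = equidistant x y" for x y
    by (auto simp: E_def equidistant_def)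
  have P_pair: "{x, y} \<in> P" if "x \<in> V" "y \<in> V" "x \<noteq> y" for x y
    using that by (simp add: P_def)
  have surj: "\<exists>x\<in>V. \<exists>y\<in>V. x \<noteq> y \<and> equidistant x y = {a, b}" if ab: "a \<in> V" "b \<in> V" "a \<noteq> b" for a b
  proof -
    obtain x y where xy: "x \<in> V" "y \<in> V" "x \<noteq> y" "d x a = d y a" "d x b = d y b"
      using pair_not_resolving[OF ab] by blast
    have "{a, b} \<subseteq> equidistant x y"
      using xy ab by (auto simp: equidistant_def)
    moreover have "card (equidistant x y) \<le> card {a, b}"
      using card_equidistant_le[OF xy(1-3)] ab by (simp add: equidistant_def)
    ultimately have "{a, b} = equidistant x y"
      by (intro card_seteq) auto
    then show ?thesis using xy by blast
  qed
  have fin: "finite P"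
    unfolding P_def by (rule finite_subset[of _ "Pow V"]) auto
  have sub: "P \<subseteq> E ` P"
  proof
    fix A assume "A \<in> P"
    then obtain a b where "A = {a, b}" "a \<in> V" "b \<in> V" "a \<noteq> b"
      by (auto simp: P_def card_2_iff)
    then obtain x y where "x \<in> V" "y \<in> V" "x \<noteq> y" "equidistant x y = A"
      using surj by blast
    then show "A \<in> E ` P"
      using P_pair E_pair by blast
  qed
  have inj: "inj_on E P"
    using fin sub by (rule finite_surj_inj)
  have "P = E ` P"
    using fin sub card_image_le[OF fin] by (intro card_seteq) auto
  then have EP: "E B \<in> P" if "B \<in> P" for B
    using that by blast
  show "card (equidistant x y) = 2" if "x \<in> V" "y \<in> V" "x \<noteq> y" for x y
    using EP[OF P_pair[OF that]] by (simp add: E_pair P_def)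
  show "{x, y} = {u, v}" if "x \<in> V" "y \<in> V" "x \<noteq> y" "u \<in> V" "v \<in> V" "u \<noteq> v"
      "equidistant x y = equidistant u v" for x y u v
    using inj_onD[OF inj, of "{x, y}" "{u, v}"] that P_pair E_pair by simp
  show "\<exists>x\<in>V. \<exists>y\<in>V. x \<noteq> y \<and> equidistant x y = {a, b}" if "a \<in> V" "b \<in> V" "a \<noteq> b" for a b
    using surj[OF that] .
qed

lemma equidistant_three:
  assumes "x \<in> V" "y \<in> V" "x \<noteq> y" "{p, q, r} \<subseteq> equidistant x y" "p \<noteq> q" "p \<noteq> r" "q \<noteq> r"
  shows False
proof -
  have "card {p, q, r} \<le> card (equidistant x y)"
    using assms by (intro card_mono) auto
  then show False using card_equidistant assms by simp
qed

section \<open>Sizes of spheres around a vertex\<close>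

text \<open>Ordered pairs of distinct vertices on a common sphere around \<open>w\<close> are
  counted in two ways. The vertices equidistant from such a pair are \<open>w\<close> and one
  further \<open>a\<close>, and each \<open>a\<close> arises from exactly two ordered pairs, which
  gives \<open>2 * (card V - 1)\<close>. Counting each \<open>x\<close> in its own sphere adds
  \<open>card V - 1\<close>.\<close>

lemma sum_level_sizes:
  assumes w: "w \<in> V"
  shows "(\<Sum>x\<in>V - {w}. card (level w (d w x))) = 3 * (card V - 1)"
proof -
  define Ps where "Ps a = {(x, y). x \<in> V \<and> y \<in> V \<and> x \<noteq> y \<and> equidistant x y = {w, a}}" for a
  have finPs: "finite (Ps a)" for a
    by (rule finite_subset[of _ "V \<times> V"]) (auto simp: Ps_def)
  have cardPs: "card (Ps a) = 2" if a: "a \<in> V - {w}" for a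
  proof -
    obtain x y where xy: "x \<in> V" "y \<in> V" "x \<noteq> y" "equidistant x y = {w, a}"
      using equidistant_surj[of w a] w a by auto
    have "Ps a = {(x, y), (y, x)}"
    proof (intro equalityI subsetI)
      fix p assume "p \<in> Ps a"
      then obtain u v where p: "p = (u, v)" "u \<in> V" "v \<in> V" "u \<noteq> v" "equidistant u v = {w, a}"
        by (auto simp: Ps_def)
      then have "{u, v} = {x, y}"
        using equidistant_inj xy by metis
      then show "p \<in> {(x, y), (y, x)}"
        using p by (auto simp: doubleton_eq_iff)
    qed (use xy equidistant_commute in \<open>auto simp: Ps_def\<close>)
    then show ?thesis using xy by auto
  qed
  have "(SIGMA x:V - {w}. level w (d w x) - {x}) = (\<Union>a\<in>V - {w}. Ps a)"
  proof (intro equalityI subsetI)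
    fix p assume pS: "p \<in> (SIGMA x:V - {w}. level w (d w x) - {x})"
    obtain x y where xy: "p = (x, y)" by (cases p)
    with pS have p: "p = (x, y)" "x \<in> V" "y \<in> V" "x \<noteq> y" "d w x = d w y"
      by (auto simp: level_def)
    then have "w \<in> equidistant x y"
      using w by (simp add: equidistant_def dist_sym)
    moreover have "card (equidistant x y) = 2"
      using card_equidistant[of x y] p by auto
    ultimately obtain a where "equidistant x y = {w, a}" "a \<noteq> w"
      by (auto simp: card_2_iff doubleton_eq_iff)
    moreover from this have "a \<in> V"
      by (auto simp: equidistant_def)
    ultimately show "p \<in> (\<Union>a\<in>V - {w}. Ps a)"
      using p by (auto simp: Ps_def)
  next
    fix p assume "p \<in> (\<Union>a\<in>V - {w}. Ps a)"
    then obtain a x y where p: "p = (x, y)" "x \<in> V" "y \<in> V" "x \<noteq> y" "equidistant x y = {w, a}"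
      by (auto simp: Ps_def)
    then have "w \<in> equidistant x y" by simp
    then have eq: "d w x = d w y"
      using w p by (simp add: equidistant_def dist_sym)
    moreover have "x \<noteq> w"
      using p eq w dist_eq_0 by metis
    ultimately show "p \<in> (SIGMA x:V - {w}. level w (d w x) - {x})"
      using p by (auto simp: level_def)
  qed
  moreover have "card (SIGMA x:V - {w}. level w (d w x) - {x}) = (\<Sum>x\<in>V - {w}. card (level w (d w x) - {x}))"
    by (intro card_SigmaI) auto
  moreover have "card (\<Union>a\<in>V - {w}. Ps a) = (\<Sum>a\<in>V - {w}. card (Ps a))"
    by (intro card_UN_disjoint) (use finPs in \<open>auto simp: Ps_def doubleton_eq_iff\<close>)
  ultimately have "(\<Sum>x\<in>V - {w}. card (level w (d w x) - {x})) = 2 * (card V - 1)"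
    using cardPs w by simp
  moreover have "(\<Sum>x\<in>V - {w}. card (level w (d w x))) = (\<Sum>x\<in>V - {w}. card (level w (d w x) - {x}) + 1)"
  proof (intro sum.cong refl)
    show "card (level w (d w x)) = card (level w (d w x) - {x}) + 1" if "x \<in> V - {w}" for x
      using card_Suc_Diff1[of "level w (d w x)" x] that by (simp add: level_def)
  qed
  ultimately show ?thesis
    using w by (simp add: sum_Suc)
qed

text \<open>Two vertices of level \<open>k + 1\<close> with a common neighbour \<open>u\<close> in level \<open>k \<ge> 2\<close> would be
  equidistant from \<open>u\<close>, from a neighbour of \<open>u\<close> in level \<open>k - 1\<close> and from \<open>w\<close>.\<close>

lemma level_card_Suc_le:
  assumes w: "w \<in> V" and k: "k \<ge> 2"
  shows "card (level w (Suc k)) \<le> card (level w k)"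
proof -
  define par where "par x = (SOME u. u \<in> V \<and> d w u = k \<and> d u x = 1)" for x
  have par: "par x \<in> V" "d w (par x) = k" "d (par x) x = 1" if "x \<in> level w (Suc k)" for x
  proof -
    have "\<exists>u. u \<in> V \<and> d w u = k \<and> d u x = 1"
      using dist_step[of w x k] that w by (auto simp: level_def)
    then have "par x \<in> V \<and> d w (par x) = k \<and> d (par x) x = 1"
      unfolding par_def by (rule someI_ex)
    then show "par x \<in> V" "d w (par x) = k" "d (par x) x = 1" by auto
  qed
  have "inj_on par (level w (Suc k))"
  proof (rule inj_onI, rule ccontr)
    fix x y assume xy: "x \<in> level w (Suc k)" "y \<in> level w (Suc k)" "par x = par y" "x \<noteq> y"
    then have V: "x \<in> V" "y \<in> V" by (auto simp: level_def)
    define u where "u = par x"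
    have u: "u \<in> V" "d w u = k" "d u x = 1" "d u y = 1"
      using par[OF xy(1)] par[OF xy(2)] xy(3) by (auto simp: u_def)
    obtain k' where k': "k = Suc k'" using k by (cases k) auto
    obtain t where t: "t \<in> V" "d w t = k'" "d t u = 1"
      using dist_step[of w u k'] u w k' by auto
    \<comment> \<open>The lower bound comes from the levels \<open>k - 1\<close> of \<open>t\<close>
      and \<open>k + 1\<close> of \<open>z\<close>, the upper bound from the path through
      \<open>u\<close>.\<close>
    have "d t z = 2" if "z \<in> V" "d w z = Suc k" "d u z = 1" for z
      using dist_triangle[of t u z] dist_triangle[of w t z] that t u w k' by simp
    then have "d t x = d t y"
      using xy V u by (simp add: level_def)
    then have "d x t = d y t"
      using V t by (simp add: dist_sym)
    moreover have "d x u = d y u" using u V by (simp add: dist_sym)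
    moreover have "d x w = d y w" using xy w V by (simp add: level_def dist_sym)
    ultimately have "{w, u, t} \<subseteq> equidistant x y"
      using w u t by (simp add: equidistant_def)
    \<comment> \<open>\<open>w\<close> and \<open>t\<close> differ because \<open>t\<close> lies on
      level \<open>k - 1\<close>, which is positive by \<open>k \<ge> 2\<close>.\<close>
    moreover have "w \<noteq> u" "w \<noteq> t" "u \<noteq> t"
      using u t k k' w dist_eq_0[of w w] by auto
    ultimately show False
      using equidistant_three V xy(4) by blast
  qed
  moreover have "par ` level w (Suc k) \<subseteq> level w k"
    using par by (auto simp: level_def)
  ultimately show ?thesis
    by (intro card_inj_on_le) auto
qed

lemma level_card_le_level_2:
  assumes w: "w \<in> V" and "k \<ge> 2"
  shows "card (level w k) \<le> card (level w 2)"
  using assms(2)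
proof (induction k rule: dec_induct)
  case (step k)
  then show ?case using level_card_Suc_le[OF w, of k] by linarith
qed simp

section \<open>Distances to the neighbours of a vertex\<close>

text \<open>Double count of triples \<open>(z, a, b)\<close> with \<open>z\<close> equidistant from
  the neighbours \<open>a\<close> and \<open>b\<close> of \<open>w\<close>: each diagonal pair
  \<open>a = b\<close> contributes \<open>card V\<close>, every other ordered pair contributes 2.
  The vertex \<open>z = w\<close>, which contributes the square of \<open>card N\<close>, is split
  off. The summand \<open>card N\<close> on the left avoids truncated subtraction.\<close>

lemma neighbour_equidistant_count:
  assumes w: "w \<in> V"
  defines "N \<equiv> level w 1"
  shows "(\<Sum>z\<in>V - {w}. \<Sum>a\<in>N. card {b\<in>N. d z a = d z b}) + card N
       = card N * (card V - 1) + card N * card N"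
proof -
  have NV: "a \<in> V" if "a \<in> N" for a using that by (simp add: N_def level_def)
  have fN: "finite N" by (simp add: N_def)
  have row: "(\<Sum>b\<in>N. card {z\<in>V. d z a = d z b}) + 2 = card V + 2 * card N" if a: "a \<in> N" for a
  proof -
    have "(\<Sum>b\<in>N. card {z\<in>V. d z a = d z b}) = card V + (\<Sum>b\<in>N - {a}. card {z\<in>V. d z a = d z b})"
      using sum.remove[OF fN a, of "\<lambda>b. card {z\<in>V. d z a = d z b}"] by simp
    also have "(\<Sum>b\<in>N - {a}. card {z\<in>V. d z a = d z b}) = (\<Sum>b\<in>N - {a}. 2)"
    proof (intro sum.cong refl)
      fix b assume b: "b \<in> N - {a}"
      have "{z\<in>V. d z a = d z b} = equidistant a b"
        using NV a b by (auto simp: equidistant_def dist_sym)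
      then show "card {z\<in>V. d z a = d z b} = 2"
        using card_equidistant[of a b] NV a b by auto
    qed
    finally have "(\<Sum>b\<in>N. card {z\<in>V. d z a = d z b}) = card V + 2 * (card N - 1)"
      using a fN by simp
    moreover have "card N > 0" using a fN card_gt_0_iff by blast
    ultimately show ?thesis by simp
  qed
  have "(\<Sum>z\<in>V. \<Sum>a\<in>N. card {b\<in>N. d z a = d z b}) = (\<Sum>z\<in>V. \<Sum>a\<in>N. \<Sum>b\<in>N. if d z a = d z b then 1 else 0)"
    using fN by (simp only: card_filter_eq_sum)
  also have "\<dots> = (\<Sum>a\<in>N. \<Sum>z\<in>V. \<Sum>b\<in>N. if d z a = d z b then 1 else 0)"
    by (rule sum.swap)
  also have "\<dots> = (\<Sum>a\<in>N. \<Sum>b\<in>N. \<Sum>z\<in>V. if d z a = d z b then 1 else 0)"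
    by (intro sum.cong refl sum.swap)
  also have "\<dots> = (\<Sum>a\<in>N. \<Sum>b\<in>N. card {z\<in>V. d z a = d z b})"
    by (simp only: card_filter_eq_sum[OF finite_V])
  finally have "(\<Sum>z\<in>V. \<Sum>a\<in>N. card {b\<in>N. d z a = d z b}) + 2 * card N
      = (\<Sum>a\<in>N. (\<Sum>b\<in>N. card {z\<in>V. d z a = d z b}) + 2)"
    by (simp only: sum.distrib) simp
  also have "\<dots> = card N * (card V + 2 * card N)"
    using row by simp
  finally have 1: "(\<Sum>z\<in>V. \<Sum>a\<in>N. card {b\<in>N. d z a = d z b}) + 2 * card N = card N * (card V + 2 * card N)" .
  have "{b\<in>N. d w a = d w b} = N" if "a \<in> N" for a
    using that by (auto simp: N_def level_def)
  then have 2: "(\<Sum>a\<in>N. card {b\<in>N. d w a = d w b}) = card N * card N"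
    by simp
  have 3: "card V = Suc (card V - 1)" using card_V by simp
  have 4: "card N * (card V + 2 * card N) = card N * (card V - 1) + card N + 2 * (card N * card N)"
    by (subst 3) (simp add: algebra_simps)
  show ?thesis
    using 1 4 sum.remove[OF finite_V w, of "\<lambda>z. \<Sum>a\<in>N. card {b\<in>N. d z a = d z b}"] 2 by simp
qed

text \<open>Moving from \<open>w\<close> to a neighbour changes the distance to \<open>z\<close> by
  at most one, so the neighbours fall into three classes: closer (\<open>p\<close>), equally far,
  and farther (\<open>r\<close>). The middle class stays explicit because
  \<open>card_V_le_10\<close> sums its size over \<open>z\<close>.\<close>

lemma neighbour_classes:
  assumes w: "w \<in> V" and z: "z \<in> V"
  shows "\<exists>p r. card (level w 1) = p + card {a\<in>level w 1. d z a = d z w} + r \<and>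
    (\<Sum>a\<in>level w 1. card {b\<in>level w 1. d z a = d z b})
      = p * p + card {a\<in>level w 1. d z a = d z w} * card {a\<in>level w 1. d z a = d z w} + r * r"
proof -
  define N where "N = level w 1"
  define A where "A = {a\<in>N. Suc (d z a) = d z w}"
  define B where "B = {a\<in>N. d z a = d z w}"
  define C where "C = {a\<in>N. d z a = Suc (d z w)}"
  have fN: "finite N" by (simp add: N_def)
  have fin: "finite A" "finite B" "finite C"
    using fN by (auto simp: A_def B_def C_def)
  have cases: "Suc (d z a) = d z w \<or> d z a = d z w \<or> d z a = Suc (d z w)" if "a \<in> N" for a
  proof -
    have a: "a \<in> V" "d w a = 1" using that by (auto simp: N_def level_def)
    show ?thesis
      using dist_triangle[of z w a] dist_triangle[of z a w] dist_sym[of a w] a w z by auto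
  qed
  have N: "N = A \<union> (B \<union> C)" and disj: "A \<inter> (B \<union> C) = {}" "B \<inter> C = {}"
    using cases by (auto simp: A_def B_def C_def)
  have "{b\<in>N. d z a = d z b} = A" if "a \<in> A" for a
    using that by (auto simp: A_def)
  moreover have "{b\<in>N. d z a = d z b} = B" if "a \<in> B" for a
    using that by (auto simp: B_def)
  moreover have "{b\<in>N. d z a = d z b} = C" if "a \<in> C" for a
    using that by (auto simp: C_def)
  moreover have "(\<Sum>a\<in>N. card {b\<in>N. d z a = d z b}) = (\<Sum>a\<in>A. card {b\<in>N. d z a = d z b})
      + ((\<Sum>a\<in>B. card {b\<in>N. d z a = d z b}) + (\<Sum>a\<in>C. card {b\<in>N. d z a = d z b}))"
    using sum.union_disjoint[OF fin(1) finite_UnI[OF fin(2,3)] disj(1), of "\<lambda>a. card {b\<in>N. d z a = d z b}"]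
      sum.union_disjoint[OF fin(2,3) disj(2), of "\<lambda>a. card {b\<in>N. d z a = d z b}"] N by simp
  ultimately have "(\<Sum>a\<in>N. card {b\<in>N. d z a = d z b}) = card A * card A + (card B * card B + card C * card C)"
    by simp
  moreover have "card N = card A + (card B + card C)"
    using card_Un_disjoint[OF fin(1) finite_UnI[OF fin(2,3)] disj(1)] card_Un_disjoint[OF fin(2,3) disj(2)] N by simp
  ultimately show ?thesis
    unfolding N_def[symmetric] B_def[symmetric] by (intro exI[of _ "card A"] exI[of _ "card C"]) simp
qed

section \<open>Bounds on the degree and on the number of vertices\<close>

text \<open>If all shortest paths from \<open>w\<close> started with the same neighbour
  \<open>u\<close>, no vertex would be equidistant from \<open>w\<close> and
  \<open>u\<close>.\<close>

lemma degree_ge_2: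
  assumes w: "w \<in> V"
  shows "card (level w 1) \<ge> 2"
proof (rule ccontr)
  assume "\<not> ?thesis"
  then have le: "card (level w 1) \<le> 1" by simp
  obtain y where y: "y \<in> V" "y \<noteq> w"
    using card_V card_le_Suc0_iff_eq[OF finite_V] w by (metis Suc_lessD not_less numeral_3_eq_3 One_nat_def le_less_trans less_imp_le)
  have nb: "\<exists>u\<in>level w 1. Suc (d u y) = d w y" if y: "y \<in> V" "y \<noteq> w" for y
  proof -
    obtain k where k: "d y w = Suc k"
      using y w dist_eq_0[of y w] by (cases "d y w") auto
    then obtain u where "u \<in> V" "d y u = k" "d u w = 1"
      using dist_step[of y w k] y w by blast
    then show ?thesis
      using k y w by (auto simp: level_def dist_sym)
  qed
  obtain u where u: "u \<in> level w 1" using nb[OF y] by blast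
  then have uV: "u \<in> V" "d w u = 1" by (auto simp: level_def)
  then have "w \<noteq> u" using dist_eq_0[of w u] w by auto
  have "level w 1 = {u}"
    using le u by (metis One_nat_def card_le_Suc0_iff_eq finite_level is_singletonI' is_singleton_the_elem singletonD empty_iff)
  then have nb': "Suc (d u y) = d w y" if "y \<in> V" "y \<noteq> w" for y
    using nb[OF that] by simp
  have "equidistant w u = {}"
  proof -
    have "d w z \<noteq> d u z" if "z \<in> V" for z
      using nb'[of z] that w uV dist_sym[of u w] by (cases "z = w") auto
    then show ?thesis by (auto simp: equidistant_def)
  qed
  then show False
    using card_equidistant[of w u] w uV \<open>w \<noteq> u\<close> by simp
qed

text \<open>Counting leaves only degree 4 with six other vertices. The two of them outside
  \<open>N\<close> are then alone on their spheres. The farther one has all its neighbours on the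
  sphere just below, which is a singleton, so it is a leaf.\<close>

lemma degree_le_3:
  assumes w: "w \<in> V"
  shows "card (level w 1) \<le> 3"
proof (rule ccontr)
  define N m f where "N = level w 1" and "m = card N" and "f x = card (level w (d w x))" for x
  define R where "R = V - {w} - N"
  assume "\<not> ?thesis"
  then have m: "m \<ge> 4" by (simp add: m_def N_def)
  define n where "n = card V - 1"
  have n: "n \<ge> 3" using card_V by (simp add: n_def)
  have N_sub: "N \<subseteq> V - {w}"
    using w by (auto simp: N_def level_def)
  have fN: "finite N" by (simp add: N_def)
  have fR: "finite R" by (simp add: R_def)
  have nR: "n = m + card R"
    using N_sub fN w card_mono[OF _ N_sub] by (simp add: R_def n_def m_def card_Diff_subset)
  have "f x = m" if "x \<in> N" for x
    using that by (simp add: f_def N_def m_def level_def)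
  then have sumN: "(\<Sum>x\<in>N. f x) = m * m"
    by (simp add: m_def)
  have "(\<Sum>x\<in>V - {w}. f x) = (\<Sum>x\<in>R. f x) + (\<Sum>x\<in>N. f x)"
    unfolding R_def by (rule sum.subset_diff[OF N_sub]) simp
  then have sumR: "(\<Sum>x\<in>R. f x) + m * m = 3 * n"
    using sum_level_sizes[OF w] sumN by (simp add: f_def n_def)
  have f1: "f x \<ge> 1" if "x \<in> R" for x
  proof -
    have "x \<in> level w (d w x)" using that by (simp add: R_def level_def)
    then show ?thesis unfolding f_def using card_gt_0_iff[of "level w (d w x)"] by force
  qed
  have lower: "card R \<le> (\<Sum>x\<in>R. f x)"
    using sum_mono[of R "\<lambda>_. 1" f] f1 by simp
  \<comment> \<open>Each of the three classes of size \<open>p\<close> contributes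
    \<open>p * p\<close>, which is at least \<open>3 * p - 2\<close>.\<close>
  have "3 * m - 6 \<le> (\<Sum>a\<in>N. card {b\<in>N. d z a = d z b})" if z: "z \<in> V - {w}" for z
  proof -
    obtain p r where "card N = p + card {a\<in>N. d z a = d z w} + r"
      "(\<Sum>a\<in>N. card {b\<in>N. d z a = d z b}) = p * p + card {a\<in>N. d z a = d z w} * card {a\<in>N. d z a = d z w} + r * r"
      using neighbour_classes[OF w, of z] z unfolding N_def by blast
    then show ?thesis
      using three_mult_le_square_plus_2[of p] three_mult_le_square_plus_2[of r] three_mult_le_square_plus_2[of "card {a\<in>N. d z a = d z w}"] by (simp add: m_def)
  qed
  then have "(\<Sum>z\<in>V - {w}. 3 * m - 6) \<le> (\<Sum>z\<in>V - {w}. \<Sum>a\<in>N. card {b\<in>N. d z a = d z b})"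
    by (intro sum_mono) auto
  then have upper: "n * (3 * m - 6) + m \<le> m * n + m * m"
    using neighbour_equidistant_count[OF w] w by (simp add: N_def m_def n_def)
  obtain j where j: "m = j + 4" using m by (metis add.commute le_Suc_ex)
  have "n * (3 * m - 6) = n * (2 * j + 2) + m * n"
    by (simp add: j algebra_simps)
  then have u2: "n * (2 * j + 2) + m \<le> m * m"
    using upper by simp
  have l2: "m * m \<le> 2 * n + m"
    using lower sumR nR by simp
  \<comment> \<open>\<open>u2\<close> and \<open>l2\<close> sandwich \<open>m * m\<close> and leave
    no room for the term \<open>n * (2 * j)\<close>.\<close>
  have "n * (2 * j) = 0"
    using u2 l2 distrib_left[of n "2 * j" 2] by linarith
  then have "j = 0" using n by simp
  then have m4: "m = 4" and n6: "n = 6" using j u2 l2 by auto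
  have cardR: "card R = 2" and "(\<Sum>x\<in>R. f x) = 2"
    using nR m4 n6 sumR by auto
  have fR1: "f x = 1" if "x \<in> R" for x
  proof -
    have "(\<Sum>x\<in>R. f x) = f x + (\<Sum>x\<in>R - {x}. f x)"
      using sum.remove[OF fR that] .
    moreover have "(\<Sum>x\<in>R - {x}. 1) \<le> (\<Sum>x\<in>R - {x}. f x)"
      by (rule sum_mono) (use f1 in auto)
    moreover have "card (R - {x}) = 1" using that cardR fR by simp
    ultimately show ?thesis
      using f1[OF that] \<open>(\<Sum>x\<in>R. f x) = 2\<close> by simp
  qed
  have R2: "d w x \<ge> 2" if "x \<in> R" for x
  proof -
    have "x \<in> V" "x \<noteq> w" "d w x \<noteq> 1" using that by (auto simp: R_def N_def level_def)
    then have "d w x \<noteq> 0" "d w x \<noteq> 1" using w by auto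
    then show ?thesis by simp
  qed
  have same: "x = y" if "x \<in> R" "y \<in> V" "d w x = d w y" for x y
  proof -
    have "x \<in> level w (d w x)" "y \<in> level w (d w x)"
      using that by (auto simp: R_def level_def)
    moreover have "card (level w (d w x)) = 1" using fR1[OF that(1)] by (simp add: f_def)
    ultimately show ?thesis by (metis card_1_singletonE singletonD)
  qed
  obtain x y where xy: "R = {x, y}" "x \<noteq> y" using cardR by (auto simp: card_2_iff)
  have "d w x \<noteq> d w y" using same[of x y] xy by (auto simp: R_def)
  then obtain v where v: "v \<in> R" "d w v \<ge> 3" "\<forall>x\<in>V. d w x \<le> d w v"
  proof -
    define v where "v = (if d w x < d w y then y else x)"
    have v: "v \<in> R" "d w v \<ge> 3" "\<forall>x\<in>R. d w x \<le> d w v"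
      using \<open>d w x \<noteq> d w y\<close> R2[of x] R2[of y] xy by (auto simp: v_def)
    moreover have "d w t \<le> d w v" if "t \<in> V" for t
    proof (cases "t \<in> R")
      case False
      then have "t = w \<or> d w t = 1" using that by (auto simp: R_def N_def level_def)
      then show ?thesis using v(2) w dist_eq_0[of w w] by auto
    qed (use v in auto)
    ultimately show ?thesis using that by blast
  qed
  have vV: "v \<in> V" using v by (simp add: R_def)
  \<comment> \<open>Adjacent vertices differ by at most one in distance from \<open>w\<close>;
    \<open>v\<close> is farthest, and no other vertex shares its sphere.\<close>
  have down: "d w t = d w v - 1" if "t \<in> level v 1" for t
  proof -
    have t: "t \<in> V" "d v t = 1" using that by (auto simp: level_def)
    then have "t \<noteq> v" using vV dist_eq_0[of v v] by auto
    then have "d w t \<noteq> d w v" using same[of v t] v t by auto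
    moreover have "d w t \<le> d w v" using v t by blast
    moreover have "d w v \<le> d w t + 1"
      using dist_triangle[of w t v] dist_sym[of t v] t vV w by simp
    ultimately show ?thesis by simp
  qed
  have "s = t" if "s \<in> level v 1" "t \<in> level v 1" for s t
  proof -
    have "s \<in> V" "t \<in> V" using that by (auto simp: level_def)
    moreover have "s \<in> R"
      using down[OF that(1)] v(2) w dist_eq_0[of w w] \<open>s \<in> V\<close> by (auto simp: R_def N_def level_def)
    ultimately show ?thesis using same[of s t] down that by simp
  qed
  then have "card (level v 1) \<le> Suc 0"
    by (subst card_le_Suc0_iff_eq) auto
  then show False using degree_ge_2[OF vV] by simp
qed

text \<open>For classes of sizes \<open>p\<close>, \<open>q\<close>, \<open>r\<close> with sum 3,
  the sum of squares is below 5 only for sizes 1, 1, 1; the weight 2 on the middle class makes up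
  for this. Summing the bound 5 over the \<open>n\<close> vertices other than \<open>w\<close>,
  where the middle classes total 6, gives \<open>5 * n \<le> 12 + (3 * n + 6)\<close>.\<close>

lemma card_V_le_10:
  assumes w: "w \<in> V" and deg: "card (level w 1) = 3"
  shows "card V \<le> 10"
proof -
  define N where "N = level w 1"
  define n where "n = card V - 1"
  define S where "S z = (\<Sum>a\<in>N. card {b\<in>N. d z a = d z b})" for z
  define q where "q z = card {a\<in>N. d z a = d z w}" for z
  have fN: "finite N" by (simp add: N_def)
  have cN: "card N = 3" using deg by (simp add: N_def)
  have ge: "5 \<le> 2 * q z + S z" if z: "z \<in> V - {w}" for z
  proof -
    obtain p r where pr: "p + q z + r = 3" "S z = p * p + q z * q z + r * r"
      using neighbour_classes[OF w, of z] z cN unfolding N_def S_def q_def by auto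
    have "q z \<in> {0, 1, 2, 3}" "p \<in> {0, 1, 2, 3}" using pr(1) by auto
    then show ?thesis using pr by auto
  qed
  have "(\<Sum>z\<in>V - {w}. q z) = (\<Sum>z\<in>V - {w}. \<Sum>a\<in>N. if d z a = d z w then 1 else 0)"
    using fN by (simp only: q_def card_filter_eq_sum)
  also have "\<dots> = (\<Sum>a\<in>N. \<Sum>z\<in>V - {w}. if d z a = d z w then 1 else 0)"
    by (rule sum.swap)
  also have "\<dots> = (\<Sum>a\<in>N. card {z\<in>V - {w}. d z a = d z w})"
    by (simp only: card_filter_eq_sum finite_Diff finite_V)
  also have "\<dots> = (\<Sum>a\<in>N. 2)"
  proof (intro sum.cong refl)
    fix a assume a: "a \<in> N"
    then have aV: "a \<in> V" "d w a = 1" by (auto simp: N_def level_def)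
    then have "a \<noteq> w" using w dist_eq_0[of w w] by auto
    have "{z\<in>V - {w}. d z a = d z w} = equidistant a w"
    proof (rule set_eqI)
      show "z \<in> {z\<in>V - {w}. d z a = d z w} \<longleftrightarrow> z \<in> equidistant a w" for z
        using aV w dist_sym[of a w] dist_sym[of z a] dist_sym[of z w]
        by (cases "z = w") (auto simp: equidistant_def)
    qed
    then show "card {z\<in>V - {w}. d z a = d z w} = 2"
      using card_equidistant[of a w] aV w \<open>a \<noteq> w\<close> by simp
  qed
  finally have q: "(\<Sum>z\<in>V - {w}. q z) = 6" using cN by simp
  have S: "(\<Sum>z\<in>V - {w}. S z) + 3 = 3 * n + 9"
    using neighbour_equidistant_count[OF w] cN by (simp add: N_def S_def n_def)
  have "(\<Sum>z\<in>V - {w}. 5) \<le> (\<Sum>z\<in>V - {w}. 2 * q z + S z)"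
    using ge by (intro sum_mono) auto
  also have "\<dots> = 2 * (\<Sum>z\<in>V - {w}. q z) + (\<Sum>z\<in>V - {w}. S z)"
    by (simp add: sum.distrib sum_distrib_left)
  finally have "5 * n \<le> 12 + (\<Sum>z\<in>V - {w}. S z)"
    using w q by (simp add: n_def)
  then show ?thesis using S by (simp add: n_def)
qed

section \<open>Exclusion of degree 2\<close>

lemma degree_neq_2:
  assumes w: "w \<in> V"
  shows "card (level w 1) \<noteq> 2"
proof
  assume deg2: "card (level w 1) = 2"
  then obtain a b where ab: "level w 1 = {a, b}" "a \<noteq> b" by (auto simp: card_2_iff)
  have dww: "d v v = 0" if "v \<in> V" for v using that by simp
  have a: "a \<in> V" "d w a = 1" and b: "b \<in> V" "d w b = 1"
    using ab by (auto simp: level_def)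
  have nw: "w \<noteq> a" "w \<noteq> b" using a b dww[OF w] by auto
  define f where "f x = card (level w (d w x))" for x
  define C where "C v = {x\<in>level w 2. d v x = 1}" for v
  have fC: "finite (C v)" for v by (simp add: C_def)
  have C_sub: "C v \<subseteq> level v 1 - {w}" for v
    using dww[OF w] by (auto simp: C_def level_def)
  have cC: "card (C v) \<le> 2" if v: "v \<in> {a, b}" for v
  proof -
    have "w \<in> level v 1" using v a b w by (auto simp: level_def dist_sym)
    then have "card (level v 1 - {w}) \<le> 2"
      using degree_le_3[of v] v a b by auto
    then show ?thesis using card_mono[OF _ C_sub, of v] by simp
  qed
  have L2: "level w 2 = C a \<union> C b"
  proof
    show "level w 2 \<subseteq> C a \<union> C b"
    proof
      fix x assume x: "x \<in> level w 2"
      then obtain u where "u \<in> V" "d w u = 1" "d u x = 1"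
        using dist_step[of w x 1] w by (auto simp: level_def numeral_2_eq_2)
      moreover from this have "u \<in> {a, b}" using ab by (auto simp: level_def)
      ultimately show "x \<in> C a \<union> C b" using x by (auto simp: C_def)
    qed
  qed (auto simp: C_def)
  have sub: "{a, b} \<subseteq> V - {w}" using a b nw by auto
  have fab: "f a = 2" "f b = 2" using a b deg2 by (auto simp: f_def)
  have split: "(\<Sum>x\<in>V - {w}. f x) = (\<Sum>x\<in>V - {w} - {a, b}. f x) + 4"
    using sum.subset_diff[OF sub, of f] fab ab by simp
  have card_rest: "card (V - {w} - {a, b}) = card V - 3"
    using w a b nw ab(2) by (simp add: card_Diff_subset)
  have total: "(\<Sum>x\<in>V - {w} - {a, b}. f x) + 4 = 3 * (card V - 1)"
    using split sum_level_sizes[OF w] by (simp add: f_def)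
  have rest2: "d w x \<ge> 2" if "x \<in> V - {w} - {a, b}" for x
  proof -
    have "d w x \<noteq> 0" using that w by auto
    moreover have "d w x \<noteq> 1" using that ab by (auto simp: level_def)
    ultimately show ?thesis by simp
  qed
  \<comment> \<open>Otherwise all spheres from radius 2 on have at most three vertices, and the
    first sphere, with two, pulls the average below 3.\<close>
  have "\<not> card (level w 2) \<le> 3"
  proof
    assume "card (level w 2) \<le> 3"
    then have "f x \<le> 3" if "x \<in> V - {w} - {a, b}" for x
      using level_card_le_level_2[OF w rest2[OF that]] by (simp add: f_def)
    then have "(\<Sum>x\<in>V - {w} - {a, b}. f x) \<le> (\<Sum>x\<in>V - {w} - {a, b}. 3)"
      by (intro sum_mono) auto
    then show False using total card_rest card_V by simp
  qed
  then have "card (C a \<union> C b) \<ge> 4" using L2 by simp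
  moreover have "card (C a \<union> C b) + card (C a \<inter> C b) = card (C a) + card (C b)"
    using card_Un_Int[OF fC fC] by simp
  ultimately have Cab: "card (C a) = 2" "card (C b) = 2" "card (C a \<inter> C b) = 0"
    using cC[of a] cC[of b] by auto
  then have disj: "C a \<inter> C b = {}" using fC by simp
  \<comment> \<open>If the two elements of \<open>C u\<close> were equally far from
    \<open>v\<close>, then \<open>w\<close>, \<open>u\<close> and \<open>v\<close> would all be
    equidistant from them. So both possible distances 2 and 3 occur.\<close>
  have key: "\<exists>u1 u2. C u = {u1, u2} \<and> d v u1 = 2 \<and> d v u2 = 3"
    if uv: "(u = a \<and> v = b) \<or> (u = b \<and> v = a)" for u v
  proof -
    have u: "u \<in> V" "d w u = 1" "w \<noteq> u" and v: "v \<in> V" "d w v = 1" "w \<noteq> v" and "u \<noteq> v"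
      using uv a b ab nw by auto
    have "card (C u) = 2" using uv Cab by auto
    then obtain x y where xy: "C u = {x, y}" "x \<noteq> y" by (auto simp: card_2_iff)
    have V: "x \<in> V" "y \<in> V" "d w x = 2" "d w y = 2" "d u x = 1" "d u y = 1"
      using xy by (auto simp: C_def level_def)
    have rng: "d v z = 2 \<or> d v z = 3" if z: "z \<in> C u" for z
    proof -
      have zz: "z \<in> V" "d w z = 2" using z by (auto simp: C_def level_def)
      have "z \<notin> C v" using z disj uv by auto
      then have "d v z \<noteq> 1" using z by (auto simp: C_def)
      moreover have "d v z \<noteq> 0" using zz v dist_eq_0[of v z] by auto
      moreover have "d v z \<le> 3"
        using dist_triangle[of v w z] dist_sym[of v w] zz v w by simp
      ultimately show ?thesis by auto
    qed
    have "d v x \<noteq> d v y"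
    proof
      assume "d v x = d v y"
      then have "{w, u, v} \<subseteq> equidistant x y"
        using V w u v by (simp add: equidistant_def dist_sym)
      then show False
        using equidistant_three[of x y w u v] V xy u v \<open>u \<noteq> v\<close> by blast
    qed
    then show ?thesis
      using rng[of x] rng[of y] xy by (auto simp: insert_commute)
  qed
  obtain a1 a2 where A: "C a = {a1, a2}" "d b a1 = 2" "d b a2 = 3" using key[of a b] by auto
  obtain b1 b2 where B: "C b = {b1, b2}" "d a b1 = 2" "d a b2 = 3" using key[of b a] by auto
  have A': "a1 \<in> V" "a2 \<in> V" "d w a1 = 2" "d w a2 = 2" "d a a1 = 1" "d a a2 = 1" "a1 \<noteq> a2"
    using A by (auto simp: C_def level_def)
  have B': "b1 \<in> V" "b2 \<in> V" "d w b1 = 2" "d w b2 = 2" "d b b1 = 1" "d b b2 = 1" "b1 \<noteq> b2"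
    using B by (auto simp: C_def level_def)
  have wa: "w \<in> level a 1" using a w by (simp add: level_def dist_sym)
  have "card (insert w (C a)) = 3" using Cab(1) fC C_sub[of a] by (subst card_insert_disjoint) auto
  moreover have ins: "insert w (C a) \<subseteq> level a 1" using wa C_sub[of a] by auto
  ultimately have La: "card (level a 1) = 3" "level a 1 = insert w (C a)"
    using degree_le_3[OF a(1)] card_mono[OF finite_level ins] card_seteq[OF finite_level ins] by auto
  \<comment> \<open>The bound is taken at \<open>a\<close>, which has degree 3.\<close>
  have n10: "card V \<le> 10" using card_V_le_10[OF a(1) La(1)] .
  have dab: "d a b = 2"
  proof -
    have "b \<notin> level a 1" using La b nw by (auto simp: C_def level_def)
    then have "d a b \<noteq> 1" using b by (simp add: level_def)
    moreover have "d a b \<noteq> 0" using ab a b by simp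
    moreover have "d a b \<le> 2" using dist_triangle[of a w b] dist_sym[of a w] a b w by simp
    ultimately show ?thesis by simp
  qed
  have closer: "Suc (d a z) = d w z \<or> Suc (d b z) = d w z" if z: "z \<in> V" "z \<noteq> w" for z
  proof -
    obtain k where k: "d z w = Suc k" using z w dist_eq_0[of z w] by (cases "d z w") auto
    then obtain u where u: "u \<in> V" "d z u = k" "d u w = 1" using dist_step[of z w k] z w by blast
    then have "u \<in> level w 1" using w by (simp add: level_def dist_sym)
    then have "u = a \<or> u = b" using ab by auto
    then show ?thesis using u k z w a b by (auto simp: dist_sym)
  qed
  have other: "\<exists>p\<in>V. d x p = d y p \<and> p \<noteq> t" if "x \<in> V" "y \<in> V" "x \<noteq> y" for x y t
  proof -
    have "\<not> equidistant x y \<subseteq> {t}"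
      using card_equidistant[OF that] card_mono[of "{t}" "equidistant x y"] by auto
    then show ?thesis by (auto simp: equidistant_def)
  qed
  \<comment> \<open>The excluded vertices \<open>a1\<close>, \<open>b1\<close> and \<open>w\<close>
    are the known members of the three equidistant pairs; \<open>p\<close>, \<open>q\<close> and
    \<open>r\<close> are the second members.\<close>
  obtain p where p: "p \<in> V" "d w p = d b p" "p \<noteq> a1" using other[of w b a1] w b nw by auto
  obtain q where q: "q \<in> V" "d w q = d a q" "q \<noteq> b1" using other[of w a b1] w a nw by auto
  obtain r where r: "r \<in> V" "d a r = d b r" "r \<noteq> w" using other[of a b w] a b ab by auto
  have self: "d w w = 0" "d a a = 0" "d b b = 0" "d b a = 2" "d a w = 1" "d b w = 1"
    using dww w a b dab by (auto simp: dist_sym)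
  have "d w x \<noteq> d b x" if "x \<in> {w, a, b, a2, b1, b2}" for x
    using that A A' B' a b w self by (elim insertE) simp_all
  then have p': "p \<notin> {w, a, b, a1, a2, b1, b2}"
    using p by auto
  have "d w x \<noteq> d a x" if "x \<in> {w, a, b, a1, a2, b2}" for x
    using that B A' B' a b w dab self by (elim insertE) simp_all
  then have q': "q \<notin> {w, a, b, a1, a2, b1, b2}"
    using q by auto
  have "d a x \<noteq> d b x" if "x \<in> {a, b, a1, a2, b1, b2}" for x
    using that A B A' B' a b w dab self by (elim insertE) simp_all
  then have r': "r \<notin> {w, a, b, a1, a2, b1, b2}"
    using r by auto
  \<comment> \<open>A coincidence among \<open>p\<close>, \<open>q\<close>, \<open>r\<close> would
    be a vertex equidistant from \<open>w\<close>, \<open>a\<close> and \<open>b\<close>, although a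
    shortest path to \<open>w\<close> ends through \<open>a\<close> or \<open>b\<close>.\<close>
  have no_tie: "\<not> (d w z = d a z \<and> d w z = d b z)" if "z \<in> V" "z \<noteq> w" for z
    using closer[OF that] by linarith
  have pqr: "p \<noteq> q" "p \<noteq> r" "q \<noteq> r"
    using no_tie[of p] no_tie[of q] p q r p' q' by auto
  have "z \<noteq> w" "z \<noteq> a" "z \<noteq> b" if "d w z = 2" for z
    using that a b self by auto
  then have "w \<notin> {a1, a2, b1, b2}" "a \<notin> {a1, a2, b1, b2}" "b \<notin> {a1, a2, b1, b2}"
    using A'(3,4) B'(3,4) by blast+
  moreover have "{a1, a2} \<inter> {b1, b2} = {}"
    using disj A B by simp
  ultimately have dist: "distinct ([p, q, r] @ [w, a, b] @ [b1, b2, a1, a2])"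
    using A'(7) B'(7) nw ab(2) p' q' r' pqr by simp
  define T M F where "T = {p, q, r}" and "M = {b1, b2, a1, a2}" and "F = {w, a, b}"
  have sets: "set [p, q, r] = T" "set [b1, b2, a1, a2] = M" "set [w, a, b] = F"
    by (simp_all add: T_def M_def F_def)
  have disjs: "T \<inter> (F \<union> M) = {}" "F \<inter> M = {}"
    using dist unfolding distinct_append set_append sets by blast+
  have fins: "finite T" "finite M" by (simp_all add: T_def M_def)
  have card10: "card (T \<union> (F \<union> M)) = 10"
    using distinct_card[OF dist] unfolding set_append sets by simp
  moreover have "T \<union> (F \<union> M) \<subseteq> V"
    using w a b A' B' p q r by (simp add: T_def M_def F_def)
  ultimately have V: "V = T \<union> (F \<union> M)"
    using n10 card_seteq[of V "T \<union> (F \<union> M)"] by simp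
  have M2: "M = level w 2" using L2 A(1) B(1) by (auto simp: M_def)
  then have cM: "card M = 4"
    using L2 Cab card_Un_disjoint[OF fC fC disj] by simp
  have "f x = 4" if "x \<in> M" for x
    using that cM M2 by (simp add: f_def level_def)
  then have sumM: "(\<Sum>x\<in>M. f x) = 16" using cM by simp
  have "V - {w} - {a, b} = V - F" by (auto simp: F_def)
  also have "\<dots> = T \<union> M" using V disjs by blast
  \<comment> \<open>The sphere sizes total \<open>3 * 9 = 27\<close>; \<open>a\<close> and
    \<open>b\<close> account for 4 and the second sphere for 16, leaving 7 for \<open>p\<close>,
    \<open>q\<close>, \<open>r\<close>.\<close>
  finally have "(\<Sum>x\<in>T \<union> M. f x) + 4 = 27" using total V card10 by simp
  moreover have "(\<Sum>x\<in>T \<union> M. f x) = (\<Sum>x\<in>T. f x) + (\<Sum>x\<in>M. f x)"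
    using disjs by (intro sum.union_disjoint fins) blast
  ultimately have "(\<Sum>x\<in>T. f x) = 7" using sumM by simp
  then have sum7: "f p + f q + f r = 7" using pqr by (simp add: T_def)
  have far: "level w (d w x) = {y\<in>{p, q, r}. d w y = d w x}" if x: "x \<in> {p, q, r}" for x
  proof -
    have "x \<in> T" using x by (simp add: T_def)
    then have xV: "x \<in> V - {w} - {a, b}" and "x \<notin> level w 2"
      using V disjs M2 by (auto simp: F_def)
    then have "d w x \<noteq> 2" by (simp add: level_def)
    then have "d w x \<ge> 3" using rest2[OF xV] by simp
    moreover have "d w y \<le> 2" if "y \<in> F \<union> M" for y
      using that M2 a(2) b(2) self(1) by (auto simp: F_def level_def)
    ultimately have "d w y \<noteq> d w x" if "y \<in> F \<union> M" for y
      using that by fastforce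
    then have "level w (d w x) = {y\<in>T. d w y = d w x}"
      unfolding level_def using V by blast
    then show ?thesis by (simp add: T_def)
  qed
  have f3: "f x = (\<Sum>y\<in>{p, q, r}. if d w y = d w x then 1 else 0)" if "x \<in> {p, q, r}" for x
    unfolding f_def far[OF that] by (simp only: card_eq_sum sum.inter_filter finite.intros)
  define i j k where "i = d w p" and "j = d w q" and "k = d w r"
  have "f p = 1 + (if j = i then 1 else 0) + (if k = i then 1 else 0)"
    "f q = (if i = j then 1 else 0) + 1 + (if k = j then 1 else 0)"
    "f r = (if i = k then 1 else 0) + (if j = k then 1 else 0) + 1"
    using f3[of p] f3[of q] f3[of r] pqr by (simp_all add: i_def j_def k_def)
  \<comment> \<open>The sum is that of the squared block sizes of a partition of three elements,
    hence 3, 5 or 9.\<close>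
  then show False
    using sum7 by (cases "i = j"; cases "j = k"; cases "i = k") simp_all
qed

lemma degree_eq_3:
  assumes "w \<in> V"
  shows "card (level w 1) = 3"
  using degree_ge_2[OF assms] degree_le_3[OF assms] degree_neq_2[OF assms] by simp

end

section \<open>Distance in connected graphs\<close>

context wf_digraph
begin

lemma graph_dist_le: "awalk u p v \<Longrightarrow> graph_dist G u v \<le> length p"
  unfolding graph_dist_def by (rule Least_le) blast

lemma shortest_awalk:
  assumes "u \<rightarrow>\<^sup>* v"
  obtains p where "awalk u p v" "length p = graph_dist G u v"
proof -
  have "\<exists>n p. awalk u p v \<and> length p = n"
    using assms by (simp add: reachable_awalk)
  then have "\<exists>p. awalk u p v \<and> length p = graph_dist G u v"
    unfolding graph_dist_def by (rule LeastI_ex)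
  then show thesis using that by blast
qed

end

lemma (in sym_digraph) awalk_reverse:
  "awalk u p v \<Longrightarrow> \<exists>q. awalk v q u \<and> length q = length p"
proof (induction p arbitrary: u)
  case Nil
  then show ?case by (auto simp: awalk_Nil_iff intro!: exI[of _ "[]"])
next
  case (Cons e es)
  then have e: "e \<in> arcs G" "u = tail G e" "awalk (head G e) es v"
    by (auto simp: awalk_Cons_iff)
  obtain q where q: "awalk v q (head G e)" "length q = length es"
    using Cons.IH e by blast
  have "(tail G e, head G e) \<in> arcs_ends G"
    using e by (auto simp: arcs_ends_conv)
  then have "(head G e, tail G e) \<in> arcs_ends G"
    using sym_arcs by (simp add: symmetric_def symD)
  then obtain e' where "e' \<in> arcs G" "tail G e' = head G e" "head G e' = tail G e"
    by (auto simp: arcs_ends_conv)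
  then have "awalk v (q @ [e']) u"
    using q e by (intro awalk_appendI[OF q(1)]) (auto simp: awalk_simps)
  then show ?case using q by (intro exI[of _ "q @ [e']"]) simp
qed

locale connected_graph = graph +
  assumes connected: "Digraph_Component.connected G"
begin

lemma reachable: "\<lbrakk>u \<in> verts G; v \<in> verts G\<rbrakk> \<Longrightarrow> u \<rightarrow>\<^sup>* v"
  using symmetric_connected_imp_strongly_connected[OF sym_arcs connected]
  by (simp add: strongly_connected_def)

lemma graph_dist_eq_0:
  assumes "u \<in> verts G" "v \<in> verts G"
  shows "graph_dist G u v = 0 \<longleftrightarrow> u = v"
proof
  assume "graph_dist G u v = 0"
  then show "u = v"
    using shortest_awalk[OF reachable[OF assms]] by (metis awalk_empty_ends length_0_conv)
next
  assume "u = v"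
  then show "graph_dist G u v = 0"
    using graph_dist_le[of u "[]" v] assms by (simp add: awalk_Nil_iff)
qed

lemma graph_dist_sym:
  assumes "u \<in> verts G" "v \<in> verts G"
  shows "graph_dist G u v = graph_dist G v u"
proof -
  have "graph_dist G u v \<le> graph_dist G v u" if "u \<in> verts G" "v \<in> verts G" for u v
    using shortest_awalk[OF reachable[OF that(2,1)]] awalk_reverse graph_dist_le by metis
  then show ?thesis using assms by (simp add: antisym)
qed

lemma graph_dist_triangle:
  assumes "u \<in> verts G" "v \<in> verts G" "w \<in> verts G"
  shows "graph_dist G u w \<le> graph_dist G u v + graph_dist G v w"
proof -
  obtain p where p: "awalk u p v" "length p = graph_dist G u v"
    using shortest_awalk[OF reachable[OF assms(1,2)]] .
  obtain q where q: "awalk v q w" "length q = graph_dist G v w"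
    using shortest_awalk[OF reachable[OF assms(2,3)]] .
  show ?thesis
    using graph_dist_le[OF awalk_appendI[OF p(1) q(1)]] p q by simp
qed

lemma graph_dist_eq_1_iff:
  assumes "u \<in> verts G" "v \<in> verts G"
  shows "graph_dist G u v = 1 \<longleftrightarrow> (\<exists>e\<in>arcs G. tail G e = u \<and> head G e = v)"
proof
  assume "graph_dist G u v = 1"
  then obtain p where p: "awalk u p v" "length p = 1"
    using shortest_awalk[OF reachable[OF assms]] by metis
  then obtain e where "p = [e]" by (auto simp: length_Suc_conv)
  then show "\<exists>e\<in>arcs G. tail G e = u \<and> head G e = v"
    using p by (auto simp: awalk_simps)
next
  assume "\<exists>e\<in>arcs G. tail G e = u \<and> head G e = v"
  then obtain e where e: "e \<in> arcs G" "tail G e = u" "head G e = v" by blast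
  then have "graph_dist G u v \<le> 1"
    using graph_dist_le[of u "[e]" v] arc_implies_awalk[of e] by simp
  moreover have "graph_dist G u v \<noteq> 0"
    using graph_dist_eq_0[OF assms] no_loops[OF e(1)] e by simp
  ultimately show "graph_dist G u v = 1" by simp
qed

text \<open>Splitting off the last arc of a shortest walk leaves a walk of length \<open>k\<close>;
  by the triangle inequality its endpoints are no closer.\<close>

lemma graph_dist_Suc:
  assumes "u \<in> verts G" "v \<in> verts G" "graph_dist G u v = Suc k"
  shows "\<exists>x\<in>verts G. graph_dist G u x = k \<and> graph_dist G x v = 1"
proof -
  obtain p where p: "awalk u p v" "length p = Suc k"
    using shortest_awalk[OF reachable[OF assms(1,2)]] assms(3) by metis
  then obtain q e where pq: "p = q @ [e]" by (metis length_Suc_conv_rev)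
  then have e: "e \<in> arcs G" "head G e = v" and q: "awalk u q (tail G e)"
    using p by (auto simp: awalk_simps)
  have x: "tail G e \<in> verts G" using e by simp
  have "graph_dist G u (tail G e) \<le> k"
    using graph_dist_le[OF q] p pq by simp
  moreover have 1: "graph_dist G (tail G e) v = 1"
    using graph_dist_eq_1_iff[OF x assms(2)] e by blast
  moreover have "Suc k \<le> graph_dist G u (tail G e) + 1"
    using graph_dist_triangle[OF assms(1) x assms(2)] 1 assms(3) by simp
  ultimately show ?thesis using x by (intro bexI[of _ "tail G e"]) auto
qed

text \<open>Without multiple arcs, \<open>head G\<close> is injective on the arcs leaving
  \<open>v\<close>.\<close>

lemma out_degree_eq_card_sphere:
  assumes "v \<in> verts G"
  shows "out_degree G v = card {x\<in>verts G. graph_dist G v x = 1}"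
proof -
  have "inj_on (head G) (out_arcs G v)"
    by (rule inj_onI) (auto intro: no_multi_arcs simp: arc_to_ends_def)
  moreover have "head G ` out_arcs G v = {x\<in>verts G. graph_dist G v x = 1}"
    using graph_dist_eq_1_iff assms by (force simp: image_iff)
  ultimately show ?thesis
    unfolding out_degree_def by (metis card_image)
qed

section \<open>Resolving sets and the transfer to graphs\<close>

lemma resolving_set_iff:
  "resolving_set G W \<longleftrightarrow> W \<subseteq> verts G \<and>
    (\<forall>x\<in>verts G. \<forall>y\<in>verts G. (\<forall>w\<in>W. graph_dist G x w = graph_dist G y w) \<longrightarrow> x = y)"
  unfolding resolving_set_def inj_on_def metric_rep_def
  by (auto simp: restrict_def fun_eq_iff)

lemma metric_dim_le: "resolving_set G W \<Longrightarrow> metric_dim G \<le> card W"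
  unfolding metric_dim_def by (rule Least_le) blast

text \<open>All vertices but one form a resolving set, since a vertex is the only one at distance 0
  from itself. This supplies \<open>card V > 3\<close> for the metric setting.\<close>

lemma metric_dim_less_card_verts: "metric_dim G < card (verts G)"
proof -
  obtain v where v: "v \<in> verts G"
    using connected by (auto simp: connected_def strongly_connected_def)
  have "resolving_set G (verts G - {v})"
    unfolding resolving_set_iff
  proof (intro conjI ballI impI)
    fix x y assume xy: "x \<in> verts G" "y \<in> verts G"
      "\<forall>w\<in>verts G - {v}. graph_dist G x w = graph_dist G y w"
    then consider "x = v" "y = v" | "x \<in> verts G - {v}" | "y \<in> verts G - {v}" by blast
    then show "x = y"
    proof cases
      case 2
      then have "graph_dist G y x = 0" using xy(1,3) graph_dist_eq_0[of x x] by metis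
      then show ?thesis using xy graph_dist_eq_0 by metis
    next
      case 3
      then have "graph_dist G x y = 0" using xy(2,3) graph_dist_eq_0[of y y] by metis
      then show ?thesis using xy graph_dist_eq_0 by metis
    qed simp
  qed auto
  then have "metric_dim G \<le> card (verts G - {v})" by (rule metric_dim_le)
  also have "\<dots> < card (verts G)"
    using v by (intro psubset_card_mono) auto
  finally show ?thesis .
qed

end

theorem mainTheorem5:
  fixes G :: "('a, 'b) pre_digraph"
  assumes "graph G"
    and "Digraph_Component.connected G"
    and "randomly_dimensional 3 G"
  shows "regular_graph 3 G"
proof -
  interpret connected_graph G
    using assms by (simp add: connected_graph_def connected_graph_axioms_def)
  have dim: "metric_dim G = 3"
    and res: "\<And>W. \<lbrakk>W \<subseteq> verts G; card W = 3\<rbrakk> \<Longrightarrow> resolving_set G W"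
    using assms(3) by (auto simp: randomly_dimensional_def metric_basis_def)
  interpret M: randomly_3_dimensional_metric "verts G" "graph_dist G"
  proof
    show "card (verts G) > 3" using metric_dim_less_card_verts dim by simp
    show "card {z\<in>verts G. graph_dist G x z = graph_dist G y z} \<le> 2"
      if "x \<in> verts G" "y \<in> verts G" "x \<noteq> y" for x y
    proof (rule ccontr)
      assume "\<not> ?thesis"
      then have "3 \<le> card {z\<in>verts G. graph_dist G x z = graph_dist G y z}" by simp
      then obtain W where "W \<subseteq> {z\<in>verts G. graph_dist G x z = graph_dist G y z}" "card W = 3"
        by (meson obtain_subset_with_card_n)
      then show False
        using res[of W] that unfolding resolving_set_iff by blast
    qed
    show "\<exists>x\<in>verts G. \<exists>y\<in>verts G. x \<noteq> y \<and> graph_dist G x a = graph_dist G y a \<and>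
        graph_dist G x b = graph_dist G y b"
      if "a \<in> verts G" "b \<in> verts G" "a \<noteq> b" for a b
    proof -
      have "\<not> resolving_set G {a, b}"
        using metric_dim_le[of "{a, b}"] dim that by auto
      then show ?thesis using that unfolding resolving_set_iff by auto
    qed
  qed (fact finite_verts graph_dist_eq_0 graph_dist_sym graph_dist_triangle graph_dist_Suc)+
  show ?thesis
    unfolding regular_graph_def
    using M.degree_eq_3 out_degree_eq_card_sphere by (simp add: M.level_def)
qed

end
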